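(* Let $e\ge 3$ be an odd integer, $q=2^e$, and let $\mathcal{V}^3_{\varepsilon}\subset \mathrm{PG}(3,q^2)$ be the hypersurface defined in the context (with $r=3$). Then its number of $\mathbb{F}_{q^2}$-rational points is $$|\mathcal{V}^3_{\varepsilon}|=\begin{cases} q^5+q^2+1 & \text{if } e\equiv 1 \pmod 4,\\ q^5+3q^2+1 & \text{if } e\equiv 3 \pmod 4.\end{cases}$$
   Context: Let $e\ge 3$ be odd, $q=2^e$, $r\ge 2$. Points of $\mathrm{PG}(r,q^2)$ (projective space of projective dimension $r$ over $\mathbb{F}_{q^2}$) have homogeneous coordinates $(X_0,\dots,X_r)$; $\Pi_\infty$ is the hyperplane $X_0=0$, and affine coordinates on the complement $\mathrm{AG}(r,q^2)$ are $x_i=X_i/X_0$. For an exponent involving $\sigma$, $\sigma$ stands for $2^{(e+1)/2}$, i.e. $x^{\sigma}=x^{2^{(e+1)/2}}$ and $x^{\sigma+2}=x^{2^{(e+1)/2}+2}$. Fix $\varepsilon\in\mathbb{F}_{q^2}\setminus\mathbb{F}_q$ such that $\varepsilon^2+\varepsilon+\delta=0$ for some $\delta\in\mathbb{F}_q\setminus\{1\}$ with absolute trace $\mathrm{Tr}_{q/2}(\delta)=\sum_{i=0}^{e-1}\delta^{2^i}=1$. Put $$\Gamma_{\varepsilon}(x)=[x+(x^q+x)\varepsilon]^{\sigma+2}+(x^q+x)^{\sigma}+(x^{2q}+x^2)\varepsilon+x^{q+1}+x^2.$$ $\mathcal{V}^r_\varepsilon$ is the projective hypersurface of $\mathrm{PG}(r,q^2)$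 with affine equation $x_r^q+x_r=\Gamma_{\varepsilon}(x_1)+\dots+\Gamma_{\varepsilon}(x_{r-1})$, i.e. the zero locus of the homogenization (with respect to $X_0$) of the corresponding polynomial; it is identified with its set of $\mathbb{F}_{q^2}$-rational points. *)

theory Defs
  imports "HOL-Library.Poly_Mapping" "HOL-Library.Cardinality" "HOL-Number_Theory.Cong"
begin

text \<open>
  A polynomial in the variables \<open>X\<^sub>0, X\<^sub>1, \<dots>\<close> is a finitely supported map from monomials to
  coefficients, a monomial being a finitely supported map from variable indices to exponents.
  The ring structure is the convolution product on \<^type>\<open>poly_mapping\<close>.
\<close>

type_synonym 'a mpol = "(nat \<Rightarrow>\<^sub>0 nat) \<Rightarrow>\<^sub>0 'a"

definition var :: "nat \<Rightarrow> 'a::comm_ring_1 mpol" where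
  "var i = Poly_Mapping.single (Poly_Mapping.single i 1) 1"

definition const :: "'a::comm_ring_1 \<Rightarrow> 'a mpol" where
  "const c = Poly_Mapping.single 0 c"

definition eval_mpol :: "(nat \<Rightarrow> 'a::comm_ring_1) \<Rightarrow> 'a mpol \<Rightarrow> 'a" where
  "eval_mpol v p =
     (\<Sum>m\<in>Poly_Mapping.keys p. Poly_Mapping.lookup p m *
        (\<Prod>i\<in>Poly_Mapping.keys m. v i ^ Poly_Mapping.lookup m i))"

definition mon_deg :: "(nat \<Rightarrow>\<^sub>0 nat) \<Rightarrow> nat" where
  "mon_deg m = (\<Sum>i\<in>Poly_Mapping.keys m. Poly_Mapping.lookup m i)"

text \<open>The zero polynomial gets total degree 0.\<close>

definition total_deg :: "'a::comm_ring_1 mpol \<Rightarrow> nat" where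
  "total_deg p = Max (insert 0 (mon_deg ` Poly_Mapping.keys p))"

text \<open>
  Homogenization with respect to \<open>X\<^sub>0\<close>; meant for polynomials in which \<open>X\<^sub>0\<close> does not occur, so
  that the affine coordinate \<open>x\<^sub>i = X\<^sub>i / X\<^sub>0\<close> corresponds to the variable with index \<open>i \<ge> 1\<close>.
\<close>

definition homogenize :: "'a::comm_ring_1 mpol \<Rightarrow> 'a mpol" where
  "homogenize p =
     (\<Sum>m\<in>Poly_Mapping.keys p. Poly_Mapping.single
        (m + Poly_Mapping.single 0 (total_deg p - mon_deg m)) (Poly_Mapping.lookup p m))"

text \<open>
  A vector \<open>(X\<^sub>0, \<dots>, X\<^sub>r)\<close> is a function on \<^typ>\<open>nat\<close> vanishing beyond \<open>r\<close>. A point of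
  \<open>PG(r, F)\<close> is the class of a nonzero vector up to nonzero scalars; the coordinate field \<open>F\<close>
  is the whole type.
\<close>

definition nonzero_vectors :: "nat \<Rightarrow> (nat \<Rightarrow> 'a::field) set" where
  "nonzero_vectors r = {v. (\<forall>i>r. v i = 0) \<and> (\<exists>i\<le>r. v i \<noteq> 0)}"

definition proportional :: "nat \<Rightarrow> ((nat \<Rightarrow> 'a::field) \<times> (nat \<Rightarrow> 'a)) set" where
  "proportional r = {(u, v). u \<in> nonzero_vectors r \<and> v \<in> nonzero_vectors r \<and>
     (\<exists>c. c \<noteq> 0 \<and> v = (\<lambda>i. c * u i))}"

definition PG :: "nat \<Rightarrow> (nat \<Rightarrow> 'a::field) set set" where
  "PG r = nonzero_vectors r // proportional r"

definition proj_zeros :: "nat \<Rightarrow> 'a::field mpol \<Rightarrow> (nat \<Rightarrow> 'a) set set" where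
  "proj_zeros r f = {P \<in> PG r. \<forall>v\<in>P. eval_mpol v f = 0}"

text \<open>
  The subfield with \<open>q\<close> elements of a field with \<open>q\<^sup>2\<close> elements consists of the
  fixed points of \<open>x \<mapsto> x\<^sup>q\<close>.
\<close>

definition subfield_q :: "nat \<Rightarrow> 'a::field set" where
  "subfield_q q = {x. x ^ q = x}"

definition abs_trace :: "nat \<Rightarrow> 'a::field \<Rightarrow> 'a" where
  "abs_trace e x = (\<Sum>i<e. x ^ (2 ^ i))"

definition sigma_exp :: "nat \<Rightarrow> nat" where
  "sigma_exp e = 2 ^ ((e + 1) div 2)"

definition Gamma_pol :: "nat \<Rightarrow> 'a::field \<Rightarrow> 'a mpol \<Rightarrow> 'a mpol" where
  "Gamma_pol e \<epsilon> x =
     (let q = 2 ^ e; \<sigma> = sigma_exp e in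
      (x + (x ^ q + x) * const \<epsilon>) ^ (\<sigma> + 2) + (x ^ q + x) ^ \<sigma>
      + (x ^ (2 * q) + x ^ 2) * const \<epsilon> + x ^ (q + 1) + x ^ 2)"

definition V_affine_pol :: "nat \<Rightarrow> nat \<Rightarrow> 'a::field \<Rightarrow> 'a mpol" where
  "V_affine_pol e r \<epsilon> =
     var r ^ (2 ^ e) + var r - (\<Sum>i=1..r-1. Gamma_pol e \<epsilon> (var i))"

definition V :: "nat \<Rightarrow> nat \<Rightarrow> 'a::field \<Rightarrow> (nat \<Rightarrow> 'a) set set" where
  "V e r \<epsilon> = proj_zeros r (homogenize (V_affine_pol e r \<epsilon>))"

end

theory Submission
  imports Defs "HOL-Computational_Algebra.Polynomial"
begin

text \<open>
  Write \<open>x = x\<^sub>0 + x\<^sub>1 \<epsilon>\<close> with \<open>x\<^sub>0, x\<^sub>1\<close> in the field of order \<open>q\<close>. As \<open>\<epsilon>\<^sup>q = \<epsilon> + 1\<close>, the value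
  \<open>\<Gamma>(x)\<close> collapses to \<open>x\<^sub>0\<^bsup>\<sigma>+2\<^esup> + x\<^sub>1\<^bsup>\<sigma>\<^esup> + x\<^sub>0 x\<^sub>1\<close>, which lies in the small field. So over every pair
  \<open>(x, y)\<close> the affine equation \<open>z\<^sup>q + z = \<Gamma>(x) + \<Gamma>(y)\<close> prescribes a trace and has exactly \<open>q\<close>
  solutions, which gives \<open>q\<^sup>5\<close> affine points.

  On the hyperplane at infinity only the form of degree \<open>q(\<sigma>+2)\<close> survives, and it cuts out
  \<open>X\<^sub>1\<^bsup>\<sigma>+2\<^esup> = X\<^sub>2\<^bsup>\<sigma>+2\<^esup>\<close>: a cone with vertex \<open>(0:0:0:1)\<close> consisting of \<open>N\<close> lines, where \<open>N\<close> is
  the number of solutions of \<open>t\<^bsup>\<sigma>+2\<^esup> = 1\<close>. With \<open>e = 2k + 1\<close> we have \<open>\<sigma> + 2 = 2 (2\<^sup>k + 1)\<close>, and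
  \<open>t\<^bsup>2^k\<^esup> = t\<^bsup>-1\<^esup>\<close> forces \<open>t = t\<^bsup>2^(4k+2)\<^esup> = t\<^sup>4\<close>. Hence only cube roots of unity can occur, and all
  three of them do precisely when \<open>3\<close> divides \<open>2\<^sup>k + 1\<close>, that is, when \<open>k\<close> is odd.
\<close>

section \<open>Evaluation and leading forms\<close>

definition eval_mon :: "(nat \<Rightarrow> 'a::comm_ring_1) \<Rightarrow> (nat \<Rightarrow>\<^sub>0 nat) \<Rightarrow> 'a" where
  "eval_mon v m = (\<Prod>i\<in>Poly_Mapping.keys m. v i ^ Poly_Mapping.lookup m i)"

lemma eval_mpol_eval_mon:
  "eval_mpol v p = (\<Sum>m\<in>Poly_Mapping.keys p. Poly_Mapping.lookup p m * eval_mon v m)"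
  by (simp add: eval_mpol_def eval_mon_def)

text \<open>Indices outside the keys only contribute factors \<open>v i ^ 0\<close>, so monomials
  with different keys can be compared over one common index set.\<close>

lemma eval_mon_superset:
  assumes "finite S" "Poly_Mapping.keys m \<subseteq> S"
  shows "eval_mon v m = (\<Prod>i\<in>S. v i ^ Poly_Mapping.lookup m i)"
  unfolding eval_mon_def using assms
  by (intro prod.mono_neutral_left) (auto simp: in_keys_iff)

lemma mon_deg_superset:
  assumes "finite S" "Poly_Mapping.keys m \<subseteq> S"
  shows "mon_deg m = (\<Sum>i\<in>S. Poly_Mapping.lookup m i)"
  unfolding mon_deg_def using assms
  by (intro sum.mono_neutral_left) (auto simp: in_keys_iff)

lemma eval_mon_add: "eval_mon v (m + n) = eval_mon v m * eval_mon v n"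
proof -
  let ?S = "Poly_Mapping.keys m \<union> Poly_Mapping.keys n"
  have "eval_mon v k = (\<Prod>i\<in>?S. v i ^ Poly_Mapping.lookup k i)" if "k \<in> {m, n, m + n}" for k
    using that keys_add[of m n] by (intro eval_mon_superset) auto
  then show ?thesis
    by (simp add: lookup_add power_add prod.distrib)
qed

lemma mon_deg_add: "mon_deg (m + n) = mon_deg m + mon_deg n"
proof -
  let ?S = "Poly_Mapping.keys m \<union> Poly_Mapping.keys n"
  have "mon_deg k = (\<Sum>i\<in>?S. Poly_Mapping.lookup k i)" if "k \<in> {m, n, m + n}" for k
    using that keys_add[of m n] by (intro mon_deg_superset) auto
  then show ?thesis
    by (simp add: lookup_add sum.distrib)
qed

lemma eval_mon_single [simp]: "eval_mon v (Poly_Mapping.single i n) = v i ^ n"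
  by (simp add: eval_mon_superset[of "{i}"] lookup_single)

lemma mon_deg_single [simp]: "mon_deg (Poly_Mapping.single i n) = n"
  by (simp add: mon_deg_superset[of "{i}"] lookup_single)

lemma eval_mon_0 [simp]: "eval_mon v 0 = 1"
  by (simp add: eval_mon_def)

lemma mon_deg_0 [simp]: "mon_deg 0 = 0"
  by (simp add: mon_deg_def)

lemma eval_mon_scale: "eval_mon (\<lambda>i. c * v i) m = c ^ mon_deg m * eval_mon v m"
  by (simp add: eval_mon_def mon_deg_def power_mult_distrib prod.distrib power_sum)

lemma eval_mpol_single [simp]: "eval_mpol v (Poly_Mapping.single m c) = c * eval_mon v m"
  by (cases "c = 0") (auto simp: eval_mpol_eval_mon)

lemma eval_mpol_0 [simp]: "eval_mpol v 0 = 0"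
  by (simp add: eval_mpol_def)

lemma eval_mpol_add [simp]: "eval_mpol v (p + q) = eval_mpol v p + eval_mpol v q"
  unfolding eval_mpol_eval_mon
  by (rule setsum_keys_plus_distrib) (auto simp: algebra_simps)

lemma eval_mpol_uminus [simp]: "eval_mpol v (- p) = - eval_mpol v p"
  by (simp add: eval_mpol_def sum_negf)

lemma eval_mpol_diff [simp]: "eval_mpol v (p - q) = eval_mpol v p - eval_mpol v q"
  by (simp only: diff_conv_add_uminus eval_mpol_add eval_mpol_uminus)

lemma eval_mpol_sum [simp]: "eval_mpol v (\<Sum>i\<in>I. p i) = (\<Sum>i\<in>I. eval_mpol v (p i))"
  by (induction I rule: infinite_finite_induct) auto

lemma mpol_eq_sum_single:
  "p = (\<Sum>m\<in>Poly_Mapping.keys p. Poly_Mapping.single m (Poly_Mapping.lookup p m))"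
  by (rule poly_mapping_eqI)
    (simp add: lookup_sum lookup_single when_def sum.delta' in_keys_iff)

text \<open>Expanding both factors into single terms reduces multiplicativity to monomials, where it
  is \<open>eval_mon_add\<close>.\<close>

lemma eval_mpol_mult [simp]: "eval_mpol v (p * q) = eval_mpol v p * eval_mpol v q"
proof -
  let ?s = "\<lambda>p m. Poly_Mapping.single m (Poly_Mapping.lookup p m)"
  have "p * q = (\<Sum>m\<in>Poly_Mapping.keys p. ?s p m) * (\<Sum>n\<in>Poly_Mapping.keys q. ?s q n)"
    by (simp flip: mpol_eq_sum_single)
  also have "\<dots> = (\<Sum>m\<in>Poly_Mapping.keys p. \<Sum>n\<in>Poly_Mapping.keys q. ?s p m * ?s q n)"
    by (rule sum_product)
  also have "eval_mpol v \<dots> = (\<Sum>m\<in>Poly_Mapping.keys p. \<Sum>n\<in>Poly_Mapping.keys q.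
      Poly_Mapping.lookup p m * eval_mon v m * (Poly_Mapping.lookup q n * eval_mon v n))"
    by (simp add: mult_single eval_mon_add mult_ac)
  also have "\<dots> = eval_mpol v p * eval_mpol v q"
    by (simp only: eval_mpol_eval_mon sum_product)
  finally show ?thesis .
qed

lemma eval_mpol_const [simp]: "eval_mpol v (const c) = c"
  by (simp add: const_def)

lemma eval_mpol_1 [simp]: "eval_mpol v 1 = 1"
  using eval_mpol_single[of v 0 1] by simp

lemma eval_mpol_power [simp]: "eval_mpol v (p ^ n) = eval_mpol v p ^ n"
  by (induction n) auto

lemma eval_mpol_var [simp]: "eval_mpol v (var i) = v i"
  by (simp add: var_def)

section \<open>Evaluation of homogenized polynomials\<close>

lemma mon_deg_le_total_deg: "m \<in> Poly_Mapping.keys p \<Longrightarrow> mon_deg m \<le> total_deg p"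
  by (auto simp: total_deg_def intro: Max_ge)

lemma eval_homogenize:
  "eval_mpol v (homogenize p) =
    (\<Sum>m\<in>Poly_Mapping.keys p. Poly_Mapping.lookup p m * eval_mon v m * v 0 ^ (total_deg p - mon_deg m))"
  by (simp add: homogenize_def eval_mon_add mult.assoc)

lemma eval_homogenize_affine:
  "v 0 = 1 \<Longrightarrow> eval_mpol v (homogenize p) = eval_mpol v p"
  unfolding eval_homogenize by (simp add: eval_mpol_eval_mon)

lemma eval_homogenize_scale:
  "eval_mpol (\<lambda>i. c * v i) (homogenize p) = c ^ total_deg p * eval_mpol v (homogenize p)"
  unfolding eval_homogenize sum_distrib_left
proof (rule sum.cong)
  fix m assume "m \<in> Poly_Mapping.keys p"
  \<comment> \<open>The padding exponent is a truncated difference; it is exact because no monomial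
    of \<open>p\<close> exceeds the total degree.\<close>
  then have "c ^ total_deg p = c ^ mon_deg m * c ^ (total_deg p - mon_deg m)"
    using mon_deg_le_total_deg[of m p] by (simp flip: power_add)
  then show "Poly_Mapping.lookup p m * eval_mon (\<lambda>i. c * v i) m * (c * v 0) ^ (total_deg p - mon_deg m) =
      c ^ total_deg p * (Poly_Mapping.lookup p m * eval_mon v m * v 0 ^ (total_deg p - mon_deg m))"
    by (simp add: eval_mon_scale power_mult_distrib)
qed simp

text \<open>
  The form \<open>A\<close> is allowed to vanish, so that \<open>has_lead d 0 p\<close> says that \<open>p\<close> has degree below \<open>d\<close>;
  this makes the notion additive in \<open>p\<close> for fixed \<open>d\<close>.
\<close>

definition has_lead :: "nat \<Rightarrow> 'a::comm_ring_1 mpol \<Rightarrow> 'a mpol \<Rightarrow> bool" where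
  "has_lead d A p \<longleftrightarrow> (\<forall>m\<in>Poly_Mapping.keys A. mon_deg m = d) \<and>
     (\<forall>m\<in>Poly_Mapping.keys (p - A). mon_deg m < d)"

lemma keys_lead:
  assumes "has_lead d A p" "m \<in> Poly_Mapping.keys p"
  shows "mon_deg m \<le> d"
proof -
  have "m \<in> Poly_Mapping.keys A \<union> Poly_Mapping.keys (p - A)"
    using assms(2) keys_add[of A "p - A"] by auto
  with assms(1) show ?thesis
    by (auto simp: has_lead_def intro: less_imp_le)
qed

lemma has_lead_var: "has_lead 1 (var i) (var i)"
  by (simp add: has_lead_def var_def)

lemma has_lead_const: "has_lead 0 (const c) (const c)"
  by (cases "c = 0") (simp_all add: has_lead_def const_def)

lemma has_lead_add:
  assumes "has_lead d A p" "has_lead d B q"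
  shows "has_lead d (A + B) (p + q)"
proof -
  have eq: "p + q - (A + B) = (p - A) + (q - B)"
    by simp
  show ?thesis
    using assms keys_add[of A B] keys_add[of "p - A" "q - B"] unfolding has_lead_def eq by blast
qed

lemma has_lead_uminus:
  assumes "has_lead d A p"
  shows "has_lead d (- A) (- p)"
proof -
  have "- p - - A = - (p - A)"
    by simp
  with assms show ?thesis
    unfolding has_lead_def by (metis keys_minus)
qed

lemma has_lead_diff: "has_lead d A p \<Longrightarrow> has_lead d B q \<Longrightarrow> has_lead d (A - B) (p - q)"
  using has_lead_add[of d A p "- B" "- q"] by (simp add: has_lead_uminus)

lemma has_lead_mult:
  assumes "has_lead d A p" "has_lead k B q"
  shows "has_lead (d + k) (A * B) (p * q)"
proof -
  \<comment> \<open>In each summand one factor stays below its top degree, so both summands stay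
    below \<open>d + k\<close>.\<close>
  have eq: "p * q - A * B = (p - A) * q + A * (q - B)"
    by (simp add: algebra_simps)
  have 1: "mon_deg m < d + k" if m: "m \<in> Poly_Mapping.keys ((p - A) * q)" for m
  proof -
    obtain a b where "m = a + b" "a \<in> Poly_Mapping.keys (p - A)" "b \<in> Poly_Mapping.keys q"
      using m keys_mult[of "p - A" q] by blast
    moreover from this have "mon_deg a < d" "mon_deg b \<le> k"
      using assms keys_lead unfolding has_lead_def by blast+
    ultimately show ?thesis
      by (simp add: mon_deg_add)
  qed
  have 2: "mon_deg m < d + k" if m: "m \<in> Poly_Mapping.keys (A * (q - B))" for m
  proof -
    obtain a b where "m = a + b" "a \<in> Poly_Mapping.keys A" "b \<in> Poly_Mapping.keys (q - B)"
      using m keys_mult[of A "q - B"] by blast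
    moreover from this have "mon_deg a = d" "mon_deg b < k"
      using assms unfolding has_lead_def by blast+
    ultimately show ?thesis
      by (simp add: mon_deg_add)
  qed
  have 3: "mon_deg m = d + k" if m: "m \<in> Poly_Mapping.keys (A * B)" for m
  proof -
    obtain a b where "m = a + b" "a \<in> Poly_Mapping.keys A" "b \<in> Poly_Mapping.keys B"
      using m keys_mult[of A B] by blast
    moreover from this have "mon_deg a = d" "mon_deg b = k"
      using assms unfolding has_lead_def by blast+
    ultimately show ?thesis
      by (simp add: mon_deg_add)
  qed
  show ?thesis
    unfolding has_lead_def eq
    using 1 2 3 keys_add[of "(p - A) * q" "A * (q - B)"] by blast
qed

lemma has_lead_power: "has_lead d A p \<Longrightarrow> has_lead (n * d) (A ^ n) (p ^ n)"
proof (induction n)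
  case 0
  then show ?case
    by (simp add: has_lead_def)
next
  case (Suc n)
  then show ?case
    using has_lead_mult[of d A p "n * d" "A ^ n" "p ^ n"] by simp
qed

text \<open>Lets terms of smaller degree be absorbed by \<open>has_lead_add\<close> into a sum of
  degree \<open>k\<close> without changing its form.\<close>

lemma has_lead_higher: "has_lead d A p \<Longrightarrow> d < k \<Longrightarrow> has_lead k 0 p"
  using keys_lead[of d A p] by (auto simp: has_lead_def intro: le_less_trans)

text \<open>Every monomial of degree below \<open>d\<close> is padded by a positive power of
  \<open>v 0\<close> and vanishes, so only the form \<open>A\<close> survives. That \<open>A\<close>
  is nonzero pins the total degree to \<open>d\<close>; \<open>has_lead\<close> alone only bounds it
  from above.\<close>

lemma eval_homogenize_infinity:
  assumes lead: "has_lead d A p" and "A \<noteq> 0" and "v 0 = 0"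
  shows "eval_mpol v (homogenize p) = eval_mpol v A"
proof -
  have A: "mon_deg m = d \<and> Poly_Mapping.lookup p m = Poly_Mapping.lookup A m"
    if m: "m \<in> Poly_Mapping.keys A" for m
  proof -
    have "mon_deg m = d" and "m \<notin> Poly_Mapping.keys (p - A)"
      using lead m by (auto simp: has_lead_def)
    then show ?thesis
      by (simp add: in_keys_iff lookup_minus)
  qed
  then have sub: "Poly_Mapping.keys A \<subseteq> Poly_Mapping.keys p"
    by (auto simp: in_keys_iff)
  obtain m where m: "m \<in> Poly_Mapping.keys A"
    using \<open>A \<noteq> 0\<close> keys_eq_empty[of A] by blast
  have deg: "total_deg p = d"
  proof (rule antisym)
    show "total_deg p \<le> d"
      using keys_lead[OF lead] by (auto simp: total_deg_def)
    show "d \<le> total_deg p"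
      using mon_deg_le_total_deg[of m p] A[OF m] m sub by auto
  qed
  have lower: "v 0 ^ (d - mon_deg m) = 0" if "m \<in> Poly_Mapping.keys p - Poly_Mapping.keys A" for m
  proof -
    have "mon_deg m < d"
      using that lead by (auto simp: has_lead_def in_keys_iff lookup_minus)
    then show ?thesis
      using \<open>v 0 = 0\<close> by (simp add: zero_power)
  qed
  have "eval_mpol v (homogenize p) = (\<Sum>m\<in>Poly_Mapping.keys A.
      Poly_Mapping.lookup p m * eval_mon v m * v 0 ^ (total_deg p - mon_deg m))"
    unfolding eval_homogenize deg
    by (rule sum.mono_neutral_right) (use sub lower in auto)
  also have "\<dots> = eval_mpol v A"
    unfolding eval_mpol_eval_mon deg by (rule sum.cong) (use A in auto)
  finally show ?thesis .
qed

section \<open>Normalized representatives of projective points\<close>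

text \<open>One distinguished vector per projective point, so that counting equivalence classes
  becomes counting vectors.\<close>

definition normalized_vectors :: "nat \<Rightarrow> (nat \<Rightarrow> 'a::field) set" where
  "normalized_vectors r = {v. (\<forall>i>r. v i = 0) \<and> (\<exists>i\<le>r. v i = 1 \<and> (\<forall>j<i. v j = 0))}"

lemma normalized_imp_nonzero: "v \<in> normalized_vectors r \<Longrightarrow> v \<in> nonzero_vectors r"
  by (auto simp: normalized_vectors_def nonzero_vectors_def)

lemma equiv_proportional: "equiv (nonzero_vectors r) (proportional r)" (is "equiv ?A ?R")
proof (rule equivI)
  show "refl_on ?A ?R"
    by (auto simp: refl_on_def proportional_def intro: exI[of _ 1])
  show "sym ?R"
  proof (rule symI)
    fix u v :: "nat \<Rightarrow> 'a" assume "(u, v) \<in> proportional r"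
    then obtain c where "c \<noteq> 0" "v = (\<lambda>i. c * u i)" "u \<in> nonzero_vectors r" "v \<in> nonzero_vectors r"
      by (auto simp: proportional_def)
    then show "(v, u) \<in> proportional r"
      by (auto simp: proportional_def intro!: exI[of _ "inverse c"])
  qed
  show "trans ?R"
  proof (rule transI)
    fix u v w :: "nat \<Rightarrow> 'a" assume "(u, v) \<in> proportional r" "(v, w) \<in> proportional r"
    then obtain c d where "c \<noteq> 0" "v = (\<lambda>i. c * u i)" "d \<noteq> 0" "w = (\<lambda>i. d * v i)"
        "u \<in> nonzero_vectors r" "w \<in> nonzero_vectors r"
      by (auto simp: proportional_def)
    then show "(u, w) \<in> proportional r"
      by (auto simp: proportional_def mult.assoc intro!: exI[of _ "d * c"])
  qed
qed (auto simp: proportional_def)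

lemma normalized_representative:
  assumes "v \<in> nonzero_vectors r"
  obtains u where "u \<in> normalized_vectors r" "(u, v) \<in> proportional r"
proof -
  \<comment> \<open>The first nonzero coordinate, by which \<open>v\<close> is divided.\<close>
  define i where "i = (LEAST i. v i \<noteq> 0)"
  obtain k where k: "k \<le> r" "v k \<noteq> 0"
    using assms by (auto simp: nonzero_vectors_def)
  have i: "v i \<noteq> 0" "i \<le> r" "\<And>j. j < i \<Longrightarrow> v j = 0"
    using LeastI[of "\<lambda>i. v i \<noteq> 0" k] Least_le[of "\<lambda>i. v i \<noteq> 0" k] k not_less_Least
    unfolding i_def by fastforce+
  define u where "u = (\<lambda>j. inverse (v i) * v j)"
  have u: "u \<in> normalized_vectors r"
    using i assms unfolding normalized_vectors_def nonzero_vectors_def u_def by auto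
  have "v = (\<lambda>j. v i * u j)"
    using i by (auto simp: u_def)
  then have "(u, v) \<in> proportional r"
    using u i(1) assms normalized_imp_nonzero unfolding proportional_def by blast
  with u show ?thesis
    by (rule that)
qed

text \<open>A nonzero scalar preserves the position of the first nonzero coordinate; both vectors
  have a 1 there, so the scalar is 1.\<close>

lemma normalized_proportional_eq:
  assumes "u \<in> normalized_vectors r" "v \<in> normalized_vectors r" "(u, v) \<in> proportional r"
  shows "u = v"
proof -
  obtain c where c: "c \<noteq> 0" "v = (\<lambda>i. c * u i)"
    using assms(3) by (auto simp: proportional_def)
  obtain i where i: "u i = 1" "\<forall>j<i. u j = 0"
    using assms(1) by (auto simp: normalized_vectors_def)
  obtain k where k: "v k = 1" "\<forall>j<k. v j = 0"
    using assms(2) by (auto simp: normalized_vectors_def)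
  have "i = k"
  proof (rule linorder_cases[of i k])
    assume "i < k" then show ?thesis using k i c by fastforce
  next
    assume "k < i" then show ?thesis using k i c by fastforce
  qed
  then show ?thesis
    using c i k by auto
qed

text \<open>The hypothesis makes vanishing independent of the representative, so sending a
  normalized vector to its class is a bijection between the two sets.\<close>

lemma card_proj_zeros:
  assumes scale: "\<And>c v. c \<noteq> 0 \<Longrightarrow> eval_mpol v f = 0 \<Longrightarrow> eval_mpol (\<lambda>i. c * v i) f = 0"
  shows "card (proj_zeros r f) = card {v \<in> normalized_vectors r. eval_mpol v f = 0}"
proof -
  let ?cl = "\<lambda>v. proportional r `` {v}"
  have "bij_betw ?cl {v \<in> normalized_vectors r. eval_mpol v f = 0} (proj_zeros r f)"
    unfolding bij_betw_def
  proof (intro conjI inj_onI equalityI subsetI)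
    fix u v assume "u \<in> {v \<in> normalized_vectors r. eval_mpol v f = 0}"
      "v \<in> {v \<in> normalized_vectors r. eval_mpol v f = 0}" "?cl u = ?cl v"
    then show "u = v"
      using normalized_proportional_eq normalized_imp_nonzero
        eq_equiv_class[OF _ equiv_proportional] by blast
  next
    fix P assume "P \<in> ?cl ` {v \<in> normalized_vectors r. eval_mpol v f = 0}"
    then obtain v where v: "v \<in> normalized_vectors r" "eval_mpol v f = 0" "P = ?cl v"
      by auto
    then have "P \<in> PG r"
      using normalized_imp_nonzero by (auto simp: PG_def intro: quotientI)
    moreover have "eval_mpol w f = 0" if "w \<in> P" for w
      using that scale v by (auto simp: proportional_def)
    ultimately show "P \<in> proj_zeros r f"
      by (simp add: proj_zeros_def)
  next
    fix P assume P: "P \<in> proj_zeros r f"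
    then obtain v where v: "v \<in> nonzero_vectors r" "P = ?cl v"
      by (auto simp: proj_zeros_def PG_def elim: quotientE)
    obtain u where u: "u \<in> normalized_vectors r" "(u, v) \<in> proportional r"
      using normalized_representative[OF v(1)] .
    have P': "P = ?cl u"
      using equiv_class_eq[OF equiv_proportional u(2)] v by simp
    moreover have "u \<in> P"
      unfolding P' using equiv_class_self[OF equiv_proportional] normalized_imp_nonzero[OF u(1)] .
    ultimately show "P \<in> ?cl ` {v \<in> normalized_vectors r. eval_mpol v f = 0}"
      using P u by (auto simp: proj_zeros_def)
  qed
  then show ?thesis
    by (simp add: bij_betw_same_card)
qed

section \<open>Finite fields of characteristic two\<close>

text \<open>Multiplication by \<open>x\<close> permutes the nonzero elements, so their product is
  unchanged although each of its factors gains an \<open>x\<close>.\<close>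

lemma finite_field_power_minus_one:
  fixes x :: "'a::{field,finite}"
  assumes "x \<noteq> 0"
  shows "x ^ (CARD('a) - 1) = 1"
proof -
  let ?P = "\<Prod>y\<in>UNIV - {0::'a}. y"
  have "?P = (\<Prod>y\<in>UNIV - {0}. x * y)"
    by (rule prod.reindex_bij_witness[of _ "\<lambda>y. x * y" "\<lambda>y. y / x"]) (use assms in auto)
  also have "\<dots> = x ^ (CARD('a) - 1) * ?P"
    by (simp add: prod.distrib card_Diff_singleton)
  finally have "(x ^ (CARD('a) - 1) - 1) * ?P = 0"
    by (simp add: algebra_simps)
  moreover have "?P \<noteq> 0"
    by simp
  ultimately show ?thesis
    by (simp only: mult_eq_0_iff) simp
qed

lemma finite_field_power_card:
  fixes x :: "'a::{field,finite}"
  shows "x ^ CARD('a) = x"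
proof (cases "x = 0")
  case False
  have "x ^ CARD('a) = x ^ Suc (CARD('a) - 1)"
    by simp
  also have "\<dots> = x"
    unfolding power_Suc finite_field_power_minus_one[OF False] by simp
  finally show ?thesis .
qed simp

text \<open>Translation by 1 permutes the field, so the sum of all elements does not change when
  \<open>CARD('a)\<close> copies of 1 are added to it. Hence the characteristic, a prime, divides a
  power of 2.\<close>

lemma CHAR_eq_2:
  assumes "CARD('a::{field,finite}) = 2 ^ n"
  shows "CHAR('a) = 2"
proof -
  have "(\<Sum>x\<in>UNIV. x) = (\<Sum>x\<in>UNIV. x + (1::'a))"
    by (rule sum.reindex_bij_witness[of _ "\<lambda>x. x + 1" "\<lambda>x. x - 1"]) auto
  then have "of_nat CARD('a) = (0::'a)"
    by (simp add: sum.distrib)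
  then have "CHAR('a) dvd 2 ^ n"
    unfolding assms by (simp only: of_nat_eq_0_iff_char_dvd)
  moreover have prime: "prime CHAR('a)"
    by (intro prime_CHAR_semidom finite_imp_CHAR_pos finite)
  ultimately have "CHAR('a) dvd 2"
    by (blast intro: prime_dvd_power)
  with prime show ?thesis
    by (intro primes_dvd_imp_eq two_is_prime_nat)
qed

lemma char2_add_self:
  assumes "CHAR('a::field) = 2"
  shows "(x::'a) + x = 0"
proof -
  have "x + x = of_nat CHAR('a) * x"
    unfolding assms by (simp only: of_nat_numeral mult_2)
  then show ?thesis
    by (simp only: of_nat_CHAR mult_zero_left)
qed

lemma char2_uminus:
  assumes "CHAR('a::field) = 2"
  shows "- (x::'a) = x"
  using char2_add_self[OF assms] by (rule minus_unique)

lemma char2_add_eq_0_iff: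
  assumes "CHAR('a::field) = 2"
  shows "x + y = 0 \<longleftrightarrow> x = (y::'a)"
  unfolding add_eq_0_iff char2_uminus[OF assms] by auto

lemma char2_add_power:
  assumes "CHAR('a::field) = 2"
  shows "(x + y :: 'a) ^ (2 ^ n) = x ^ (2 ^ n) + y ^ (2 ^ n)"
  by (rule freshmans_dream') (simp_all only: assms two_is_prime_nat)

lemma char2_power_inject:
  assumes "CHAR('a::field) = 2"
  shows "(x::'a) ^ (2 ^ n) = y ^ (2 ^ n) \<longleftrightarrow> x = y"
proof
  assume "x ^ (2 ^ n) = y ^ (2 ^ n)"
  then have "(x + y) ^ (2 ^ n) = 0"
    by (simp only: char2_add_power[OF assms] char2_add_self[OF assms])
  then have "x + y = 0"
    by (simp only: power_eq_0_iff)
  then show "x = y"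
    by (simp only: char2_add_eq_0_iff[OF assms])
qed (simp only:)

section \<open>Cube roots of unity and the equation defining the lines at infinity\<close>

text \<open>The nonzero elements number \<open>3 * k\<close>, while \<open>X^k - 1\<close> has at
  most \<open>k\<close> roots. So some \<open>u\<close> has \<open>u ^ k \<noteq> 1\<close>, and
  \<open>w = u ^ k\<close> is a primitive cube root of unity. In characteristic two,
  \<open>t ^ 3 + 1\<close> then factors with roots \<open>1\<close>, \<open>w\<close> and
  \<open>w + 1\<close>.\<close>

lemma card_cube_roots_of_unity:
  assumes "CARD('a::{field,finite}) = 4 ^ n"
  shows "card {t::'a. t ^ 3 = 1} = 3"
proof -
  have char: "CHAR('a) = 2"
    using CHAR_eq_2[of "2 * n"] assms by (simp add: power_mult)
  define k where "k = (CARD('a) - 1) div 3"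
  have "[4 ^ n = 1 ^ n] (mod (3::nat))"
    by (rule cong_pow) (simp add: cong_def)
  then have "CARD('a) mod 3 = 1"
    using assms by (simp add: cong_def)
  then have k: "CARD('a) = Suc (3 * k)"
    unfolding k_def by presburger
  have "CARD('a) > 1"
    using card_mono[of UNIV "{0, 1::'a}"] by simp
  with k have "k > 0" by simp
  define p where "p = Polynomial.monom (1::'a) k - 1"
  have "Polynomial.coeff p k = 1"
    using \<open>k > 0\<close> by (simp add: p_def)
  then have "p \<noteq> 0" by auto
  have "degree p \<le> k"
    by (auto simp: p_def intro: degree_diff_le degree_monom_le)
  then have roots: "card {x::'a. x ^ k = 1} \<le> k"
    using card_poly_roots_bound[OF \<open>p \<noteq> 0\<close>] by (simp add: p_def poly_monom)
  obtain u :: 'a where u: "u \<noteq> 0" "u ^ k \<noteq> 1"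
  proof (rule ccontr)
    assume "\<not> thesis"
    then have "UNIV - {0} \<subseteq> {x::'a. x ^ k = 1}"
      using that by blast
    from card_mono[OF _ this] roots have "CARD('a) - 1 \<le> k"
      by (simp add: card_Diff_singleton)
    with k \<open>k > 0\<close> show False by simp
  qed
  define w where "w = u ^ k"
  have "w ^ 3 = 1"
    using finite_field_power_minus_one[OF u(1)] k by (simp add: w_def mult.commute flip: power_mult)
  then have "(w - 1) * (w\<^sup>2 + w + 1) = 0"
    by (simp add: algebra_simps power2_eq_square power3_eq_cube)
  then have w: "w\<^sup>2 + w + 1 = 0"
    using u(2) by (simp add: w_def)
  have iff: "t ^ 3 = 1 \<longleftrightarrow> t = 1 \<or> t = w \<or> t = w + 1" for t
  proof -
    have "(t + 1) * ((t + w) * (t + (w + 1))) = t ^ 3 + 1"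
    proof -
      have "w * (w + 1) = 1"
        using w char2_add_eq_0_iff[OF char, of "w\<^sup>2 + w" 1] by (simp add: power2_eq_square algebra_simps)
      moreover have "(t + w) * (t + (w + 1)) = t\<^sup>2 + (w + w) * t + t + w * (w + 1)"
        by (simp add: power2_eq_square algebra_simps)
      ultimately have "(t + w) * (t + (w + 1)) = t\<^sup>2 + t + 1"
        by (simp add: char2_add_self[OF char])
      moreover have "(t + 1) * (t\<^sup>2 + t + 1) = t ^ 3 + (t\<^sup>2 + t\<^sup>2) + (t + t) + 1"
        by (simp add: power2_eq_square power3_eq_cube algebra_simps)
      ultimately show ?thesis
        by (simp only: char2_add_self[OF char] add_0_right)
    qed
    then have "t ^ 3 + 1 = 0 \<longleftrightarrow> t + 1 = 0 \<or> t + w = 0 \<or> t + (w + 1) = 0"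
      by (metis mult_eq_0_iff)
    then show ?thesis
      by (simp only: char2_add_eq_0_iff[OF char])
  qed
  have "{t::'a. t ^ 3 = 1} = {1, w, w + 1}"
    using iff by auto
  moreover have "w \<noteq> 1" "w \<noteq> 0"
    using u by (auto simp: w_def)
  ultimately show ?thesis
    by (simp add: card_insert_if)
qed

lemma roots_of_unity_exponent:
  fixes t :: "'a::{field,finite}"
  assumes card: "CARD('a) = 2 ^ (4 * k + 2)"
  shows "t ^ (2 ^ Suc k + 2) = 1 \<longleftrightarrow> (if even k then t = 1 else t ^ 3 = 1)"
proof -
  have char: "CHAR('a) = 2"
    using CHAR_eq_2 card by blast
  have "t ^ (2 ^ Suc k + 2) = (t ^ (2 ^ k + 1)) ^ (2 ^ 1)"
    unfolding power_mult[symmetric] by (rule arg_cong[of _ _ "(^) t"]) simp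
  then have sq: "t ^ (2 ^ Suc k + 2) = 1 \<longleftrightarrow> t ^ (2 ^ k + 1) = 1"
    using char2_power_inject[OF char, of "t ^ (2 ^ k + 1)" 1 1] by simp
  have cube: "t ^ 3 = 1" if t: "t ^ (2 ^ k + 1) = 1"
  proof -
    have t0: "t \<noteq> 0"
      using t by auto
    have inv: "t ^ (2 ^ k) = inverse t"
      using t by (simp add: inverse_unique mult.commute)
    \<comment> \<open>Raising to the power \<open>2 ^ k\<close> inverts \<open>t\<close>; doing so
      twice returns \<open>t\<close>.\<close>
    have id: "t ^ (2 ^ (2 * k)) = t"
    proof -
      have "t ^ (2 ^ (2 * k)) = (t ^ (2 ^ k)) ^ (2 ^ k)"
        by (simp add: mult_2 power_add flip: power_mult)
      also have "\<dots> = inverse (t ^ (2 ^ k))"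
        by (simp add: inv power_inverse)
      finally show ?thesis
        by (simp add: inv)
    qed
    have "t = t ^ (2 ^ (4 * k + 2))"
      using finite_field_power_card[of t] card by simp
    also have "(2::nat) ^ (4 * k + 2) = 2 ^ (2 * k) * 2 ^ (2 * k) * 4"
      by (simp flip: power_add)
    also have "t ^ \<dots> = t ^ 4"
      by (simp only: power_mult[of t] id)
    also have "t ^ 4 = t * t ^ 3"
      by (simp flip: power_Suc)
    finally show ?thesis
      using t0 by simp
  qed
  \<comment> \<open>Modulo 3 the base 2 is -1, so the residue alternates with the parity of
    \<open>k\<close>.\<close>
  have pow: "(2 ^ k + 1) mod 3 = (if even k then 2 else (0::nat))"
  proof (induction k)
    case (Suc k)
    have "(2 * x + 1) mod 3 = 0" if "(x + 1) mod 3 = 2" for x :: nat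
      using that by presburger
    moreover have "(2 * x + 1) mod 3 = 2" if "(x + 1) mod 3 = 0" for x :: nat
      using that by presburger
    ultimately show ?case
      using Suc by (simp split: if_splits)
  qed simp
  show ?thesis
  proof (cases "even k")
    case True
    then obtain m where m: "2 ^ k + 1 = 3 * m + (2::nat)"
      using pow mult_div_mod_eq[of 3 "2 ^ k + 1 :: nat"] by metis
    have "t = 1" if "t ^ (2 ^ k + 1) = 1"
    proof -
      \<comment> \<open>Since \<open>t ^ 3 = 1\<close>, the exponent \<open>3 * m + 2\<close>
        reduces to 2; the exponent is written \<open>2 ^ 1\<close> to match the injectivity of
        Frobenius powers.\<close>
      have "t ^ (2 ^ 1) = 1 ^ (2 ^ 1)"
        using that cube[OF that] unfolding m by (simp add: power_add power_mult power2_eq_square)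
      then show ?thesis
        using char2_power_inject[OF char] by blast
    qed
    with True sq show ?thesis
      by auto
  next
    case False
    then have "3 dvd 2 ^ k + (1::nat)"
      using pow by (simp only: dvd_eq_mod_eq_0 if_False)
    then obtain m :: nat where "2 ^ k + 1 = 3 * m"
      by (elim dvdE)
    then show ?thesis
      using False sq cube by (auto simp: power_mult)
  qed
qed

section \<open>The quadratic extension and the hypersurface\<close>

locale quadratic_extension =
  fixes e q :: nat and \<epsilon> \<delta> :: "'a::{field,finite}"
  assumes q: "q = 2 ^ e"
    and card: "CARD('a) = q\<^sup>2"
    and eps_notin: "\<epsilon> \<notin> subfield_q q"
    and delta: "\<delta> \<in> subfield_q q"
    and eps_root: "\<epsilon>\<^sup>2 + \<epsilon> + \<delta> = 0"
begin

lemma char: "CHAR('a) = 2"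
  by (rule CHAR_eq_2[of "e * 2"]) (simp add: card q power_mult)

lemmas add_self = char2_add_self[OF char]
lemmas add_eq_0_iff = char2_add_eq_0_iff[OF char]

lemma add_self_left: "(x::'a) + (x + y) = y"
  by (simp add: add_self flip: add.assoc)

lemma add_power_q: "(x + y :: 'a) ^ q = x ^ q + y ^ q"
  unfolding q by (rule char2_add_power[OF char])

lemma add_power2: "(x + y :: 'a)\<^sup>2 = x\<^sup>2 + y\<^sup>2"
  using char2_add_power[OF char, of x y 1] by simp

lemma power_q_power_q: "((x::'a) ^ q) ^ q = x"
  using finite_field_power_card[of x] by (simp add: card power2_eq_square power_mult)

lemma q_pos: "q > 0"
  by (simp add: q)

lemma subfield_0: "0 \<in> subfield_q q"
  using q_pos by (simp add: subfield_q_def)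

lemma subfield_add: "x \<in> subfield_q q \<Longrightarrow> y \<in> subfield_q q \<Longrightarrow> x + y \<in> (subfield_q q :: 'a set)"
  by (simp add: subfield_q_def add_power_q)

lemma subfield_mult: "x \<in> subfield_q q \<Longrightarrow> y \<in> subfield_q q \<Longrightarrow> x * y \<in> (subfield_q q :: 'a set)"
  by (simp add: subfield_q_def power_mult_distrib)

lemma subfield_power:
  assumes "x \<in> subfield_q q"
  shows "x ^ n \<in> (subfield_q q :: 'a set)"
proof -
  have "(x ^ n) ^ q = (x ^ q) ^ n"
    by (simp add: mult.commute flip: power_mult)
  then show ?thesis
    using assms by (simp add: subfield_q_def)
qed

lemma eps_nonzero: "\<epsilon> \<noteq> 0"
  using eps_notin subfield_0 by auto

text \<open>Both \<epsilon> and its \<open>q\<close>-th power are roots of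
  \<open>T^2 + T + \<delta>\<close>, so their sum \<open>d\<close> satisfies
  \<open>d\<^sup>2 = d\<close>. It is nonzero because \<epsilon> lies outside the subfield.\<close>

lemma eps_power_q: "\<epsilon> ^ q = \<epsilon> + 1"
proof -
  define d where "d = \<epsilon> ^ q + \<epsilon>"
  have sq: "\<epsilon>\<^sup>2 = \<epsilon> + \<delta>"
    using eps_root add_eq_0_iff[of "\<epsilon>\<^sup>2" "\<epsilon> + \<delta>"] by (simp add: add.assoc)
  have "(\<epsilon> ^ q)\<^sup>2 = (\<epsilon>\<^sup>2) ^ q"
    by (simp add: mult.commute flip: power_mult)
  also have "\<dots> = \<epsilon> ^ q + \<delta>"
    using delta by (simp add: sq add_power_q subfield_q_def)
  finally have "d\<^sup>2 = d + (\<delta> + \<delta>)"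
    by (simp add: d_def add_power2 sq ac_simps)
  then have "d * (d - 1) = 0"
    by (simp add: add_self power2_eq_square algebra_simps)
  moreover have "d \<noteq> 0"
    using eps_notin by (simp add: d_def add_eq_0_iff subfield_q_def)
  ultimately have "d = 1"
    by simp
  then have "\<epsilon> + d = \<epsilon> + 1"
    by simp
  then show ?thesis
    by (simp add: d_def add.commute[of "\<epsilon> ^ q"] add_self_left)
qed

section \<open>Coordinates over the subfield with respect to the basis 1, \<epsilon>\<close>

text \<open>The \<epsilon>-coordinate of \<open>x\<close>: as the conjugate of \<epsilon> is
  \<open>\<epsilon> + 1\<close>, it equals the relative trace.\<close>

definition part1 :: "'a \<Rightarrow> 'a" where
  "part1 x = x ^ q + x"

definition part0 :: "'a \<Rightarrow> 'a" where
  "part0 x = x + part1 x * \<epsilon>"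

lemma part1_in: "part1 x \<in> subfield_q q"
  by (simp add: part1_def subfield_q_def add_power_q power_q_power_q add.commute)

lemma part0_in: "part0 x \<in> subfield_q q"
proof -
  have "part0 x ^ q = x ^ q + part1 x * (\<epsilon> + 1)"
    using part1_in[of x]
    by (simp add: part0_def add_power_q power_mult_distrib eps_power_q subfield_q_def)
  also have "\<dots> = part1 x * \<epsilon> + (x ^ q + (x ^ q + x))"
    by (simp add: part1_def[of x] algebra_simps)
  also have "\<dots> = part0 x"
    unfolding add_self_left part0_def by (rule add.commute)
  finally show ?thesis
    by (simp add: subfield_q_def)
qed

lemma part_decomp: "x = part0 x + part1 x * \<epsilon>"
  by (simp add: part0_def add.assoc add_self)

lemma part1_eq:
  assumes "a \<in> subfield_q q" "b \<in> subfield_q q"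
  shows "part1 (a + b * \<epsilon>) = b"
proof -
  have "part1 (a + b * \<epsilon>) = a + b * (\<epsilon> + 1) + (a + b * \<epsilon>)"
    using assms by (simp add: part1_def add_power_q power_mult_distrib eps_power_q subfield_q_def)
  also have "\<dots> = b + (a + b * \<epsilon> + (a + b * \<epsilon>))"
    by (simp add: algebra_simps)
  finally show ?thesis
    by (simp add: add_self)
qed

text \<open>The coordinates identify the whole field with pairs of subfield elements, and the whole
  field has \<open>q\<^sup>2\<close> elements.\<close>

lemma card_subfield: "card (subfield_q q :: 'a set) = q"
proof -
  let ?S = "subfield_q q :: 'a set"
  have "bij_betw (\<lambda>(a, b). a + b * \<epsilon>) (?S \<times> ?S) UNIV"
    unfolding bij_betw_def
  proof (intro conjI inj_onI)
    fix u v assume uv: "u \<in> ?S \<times> ?S" "v \<in> ?S \<times> ?S"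
      "(case u of (a, b) \<Rightarrow> a + b * \<epsilon>) = (case v of (a, b) \<Rightarrow> a + b * \<epsilon>)"
    obtain a b c d where [simp]: "u = (a, b)" "v = (c, d)"
      by (cases u, cases v)
    have eq: "a + b * \<epsilon> = c + d * \<epsilon>" and S: "a \<in> ?S" "b \<in> ?S" "c \<in> ?S" "d \<in> ?S"
      using uv by simp_all
    have "b = part1 (a + b * \<epsilon>)"
      using S by (simp add: part1_eq)
    also have "\<dots> = d"
      unfolding eq using S by (simp add: part1_eq)
    finally have "b = d" .
    with eq show "u = v"
      by simp
  next
    show "(\<lambda>(a, b). a + b * \<epsilon>) ` (?S \<times> ?S) = UNIV"
    proof (intro equalityI subsetI UNIV_I)
      fix x :: 'a
      show "x \<in> (\<lambda>(a, b). a + b * \<epsilon>) ` (?S \<times> ?S)"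
        using part_decomp[of x] part0_in part1_in by (intro image_eqI[of _ _ "(part0 x, part1 x)"]) auto
    qed
  qed
  then have "card ?S * card ?S = q\<^sup>2"
    using bij_betw_same_card card by (fastforce simp: card_cartesian_product)
  then show ?thesis
    by (simp add: power2_eq_iff_nonneg flip: power2_eq_square)
qed

text \<open>The equation fixes the \<epsilon>-coordinate of \<open>z\<close> to be \<open>c\<close>
  and leaves the other coordinate free in the subfield.\<close>

lemma card_trace_fibre:
  assumes "c \<in> subfield_q q"
  shows "card {z::'a. z ^ q + z = c} = q"
proof -
  have "{z. z ^ q + z = c} = (\<lambda>a. a + c * \<epsilon>) ` subfield_q q"
  proof (intro equalityI subsetI)
    fix z assume "z \<in> {z. z ^ q + z = c}"
    then have "z = part0 z + c * \<epsilon>"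
      using part_decomp[of z] by (simp add: part1_def)
    then show "z \<in> (\<lambda>a. a + c * \<epsilon>) ` subfield_q q"
      using part0_in by blast
  next
    fix z assume "z \<in> (\<lambda>a. a + c * \<epsilon>) ` subfield_q q"
    then show "z \<in> {z. z ^ q + z = c}"
      using part1_eq[OF _ assms] by (auto simp: part1_def)
  qed
  then show ?thesis
    by (simp add: card_image inj_on_def card_subfield)
qed

section \<open>Values and leading form of \<Gamma>\<close>

definition Gamma :: "'a \<Rightarrow> 'a" where
  "Gamma x = (x + (x ^ q + x) * \<epsilon>) ^ (sigma_exp e + 2) + (x ^ q + x) ^ sigma_exp e
     + (x ^ (2 * q) + x\<^sup>2) * \<epsilon> + x ^ (q + 1) + x\<^sup>2"

lemma eval_Gamma_pol: "eval_mpol v (Gamma_pol e \<epsilon> (var i)) = Gamma (v i)"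
  unfolding Gamma_pol_def Gamma_def Let_def q[symmetric] by simp

text \<open>Write \<open>m\<close> for \<open>part1 x\<close>. Substituting
  \<open>x ^ q = x + m\<close> turns the last three summands of \<open>Gamma x\<close> into
  \<open>m\<^sup>2 * \<epsilon> + x * m\<close>, which is \<open>m * part0 x\<close>.\<close>

lemma Gamma_parts:
  "Gamma x = part0 x ^ (sigma_exp e + 2) + part1 x ^ sigma_exp e + part0 x * part1 x"
proof -
  let ?m = "part1 x"
  have xq: "x ^ q = x + ?m"
    by (simp add: part1_def add.commute[of "x ^ q"] add_self_left)
  have "x ^ (2 * q) = (x ^ q)\<^sup>2"
    by (simp add: mult.commute flip: power_mult)
  also have "\<dots> = x\<^sup>2 + ?m\<^sup>2"
    by (simp only: xq add_power2)
  finally have "x ^ (2 * q) + x\<^sup>2 = ?m\<^sup>2"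
    by (simp add: add.commute add_self_left)
  moreover have "x ^ (q + 1) + x\<^sup>2 = x * ?m"
  proof -
    have "x ^ (q + 1) + x\<^sup>2 = x * ?m + (x\<^sup>2 + x\<^sup>2)"
      by (simp add: xq power2_eq_square algebra_simps)
    then show ?thesis
      by (simp only: add_self add_0_right)
  qed
  ultimately have "(x ^ (2 * q) + x\<^sup>2) * \<epsilon> + (x ^ (q + 1) + x\<^sup>2) = part0 x * ?m"
    by (simp add: part0_def power2_eq_square algebra_simps)
  then show ?thesis
    by (simp add: Gamma_def part0_def add.assoc flip: part1_def)
qed

lemma Gamma_in: "Gamma x \<in> subfield_q q"
  unfolding Gamma_parts
  by (intro subfield_add subfield_mult subfield_power part0_in part1_in)

text \<open>Only the power with exponent \<sigma> + 2 reaches the top degree, and within its base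
  the term \<open>x ^ q * \<epsilon>\<close> dominates because \<open>q > 1\<close>.\<close>

lemma has_lead_Gamma_pol:
  assumes "e > 0"
  shows "has_lead ((sigma_exp e + 2) * q) ((var i ^ q * const \<epsilon>) ^ (sigma_exp e + 2))
    (Gamma_pol e \<epsilon> (var i))"
proof -
  let ?s = "sigma_exp e" and ?x = "var i :: 'a mpol"
  let ?d = "(?s + 2) * q"
  have s: "?s > 0"
    by (simp add: sigma_exp_def)
  have q1: "q > 1"
    unfolding q using assms by (intro one_less_power) auto
  have x: "has_lead q 0 ?x"
    using has_lead_higher[OF has_lead_var] q1 .
  have xq: "has_lead q (?x ^ q) (?x ^ q)"
    using has_lead_power[OF has_lead_var, of q i] by simp
  have "has_lead q (?x ^ q + 0) (?x ^ q + ?x)"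
    by (intro has_lead_add xq x)
  then have tr: "has_lead q (?x ^ q) (?x ^ q + ?x)"
    by simp
  have "has_lead q (0 + ?x ^ q * const \<epsilon>) (?x + (?x ^ q + ?x) * const \<epsilon>)"
    using has_lead_mult[OF tr has_lead_const] by (intro has_lead_add x) simp
  then have 1: "has_lead ?d ((?x ^ q * const \<epsilon>) ^ (?s + 2)) ((?x + (?x ^ q + ?x) * const \<epsilon>) ^ (?s + 2))"
    using has_lead_power by fastforce
  have 2: "has_lead ?d 0 ((?x ^ q + ?x) ^ ?s)"
    using has_lead_higher[OF has_lead_power[OF tr]] q1 by simp
  have mon: "has_lead ?d 0 (?x ^ n)" if "n < ?d" for n
    using has_lead_higher[OF has_lead_power[OF has_lead_var[of i], of n]] that by simp
  have bound: "2 * q < ?d"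
    using s q1 by simp
  then have "has_lead (?d + 0) ((0 + 0) * const \<epsilon>) ((?x ^ (2 * q) + ?x ^ 2) * const \<epsilon>)"
    using q1 by (intro has_lead_mult has_lead_add mon has_lead_const) auto
  then have 3: "has_lead ?d 0 ((?x ^ (2 * q) + ?x ^ 2) * const \<epsilon>)"
    by simp
  have "has_lead ?d ((?x ^ q * const \<epsilon>) ^ (?s + 2) + 0 + 0 + 0 + 0)
    ((?x + (?x ^ q + ?x) * const \<epsilon>) ^ (?s + 2) + (?x ^ q + ?x) ^ ?s
      + (?x ^ (2 * q) + ?x ^ 2) * const \<epsilon> + ?x ^ (q + 1) + ?x ^ 2)"
    using bound q1 by (intro has_lead_add 1 2 3 mon) linarith+
  then show ?thesis
    by (simp add: Gamma_pol_def Let_def q del: power_add_numeral)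
qed

lemma eval_V_affine_pol:
  "eval_mpol v (V_affine_pol e 3 \<epsilon>) = v 3 ^ q + v 3 - (Gamma (v 1) + Gamma (v 2))"
proof -
  have "{1..3 - 1} = {1, 2::nat}"
    by auto
  then show ?thesis
    unfolding V_affine_pol_def q[symmetric] by (simp add: eval_Gamma_pol)
qed

lemma eval_homogenize_V_infinity:
  assumes "e > 0" and "v 0 = 0"
  shows "eval_mpol v (homogenize (V_affine_pol e 3 \<epsilon>)) = 0 \<longleftrightarrow>
    v 1 ^ (sigma_exp e + 2) = v 2 ^ (sigma_exp e + 2)"
proof -
  let ?n = "sigma_exp e + 2"
  let ?d = "?n * q"
  define L where "L i = (var i ^ q * const \<epsilon>) ^ ?n" for i
  have q1: "q > 1"
    unfolding q using assms by (intro one_less_power) auto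
  have mon: "has_lead ?d 0 (var 3 ^ n :: 'a mpol)" if "n \<le> q" for n
  proof -
    have "n < ?d"
      using that q1 by simp
    then show ?thesis
      using has_lead_higher[OF has_lead_power[OF has_lead_var[of 3], of n]] by simp
  qed
  have set: "{1..3 - 1} = {1, 2::nat}"
    by auto
  \<comment> \<open>The third variable occurs only to degree \<open>q\<close>, below the top degree,
    hence with zero form; \<open>var 3 ^ 1\<close> lets \<open>mon\<close> cover both of its
    powers.\<close>
  have "has_lead ?d (0 + 0 - (L 1 + L 2))
      (var 3 ^ q + var 3 ^ 1 - (Gamma_pol e \<epsilon> (var 1) + Gamma_pol e \<epsilon> (var 2)))"
    unfolding L_def using q1
    by (intro has_lead_add has_lead_diff has_lead_Gamma_pol mon \<open>e > 0\<close>) auto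
  then have lead: "has_lead ?d (- (L 1 + L 2)) (V_affine_pol e 3 \<epsilon>)"
    unfolding V_affine_pol_def set q[symmetric] by simp
  have eval_L: "eval_mpol w (L i) = (w i ^ ?n) ^ q * \<epsilon> ^ ?n" for w i
    by (simp add: L_def power_mult_distrib mult.commute flip: power_mult)
  \<comment> \<open>Evaluating at the unit vector with a 1 in coordinate 1 leaves a power of
    \<epsilon>, which shows that the leading form is not zero.\<close>
  have "eval_mpol (\<lambda>i. if i = 1 then 1 else 0) (- (L 1 + L 2)) \<noteq> (0::'a)"
    using eps_nonzero by (simp add: eval_L zero_power[OF q_pos])
  then have "- (L 1 + L 2) \<noteq> 0"
    by (metis eval_mpol_0)
  then have "eval_mpol v (homogenize (V_affine_pol e 3 \<epsilon>)) = eval_mpol v (- (L 1 + L 2))"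
    using eval_homogenize_infinity[OF lead] assms by blast
  also have "\<dots> = - ((v 1 ^ ?n) ^ q * \<epsilon> ^ ?n + (v 2 ^ ?n) ^ q * \<epsilon> ^ ?n)"
    by (simp only: eval_mpol_uminus eval_mpol_add eval_L)
  also have "\<dots> = - (((v 1 ^ ?n) ^ q + (v 2 ^ ?n) ^ q) * \<epsilon> ^ ?n)"
    by (simp only: distrib_right)
  also have "\<dots> = 0 \<longleftrightarrow> (v 1 ^ ?n) ^ q = (v 2 ^ ?n) ^ q"
    using eps_nonzero by (simp only: neg_equal_0_iff_equal mult_eq_0_iff add_eq_0_iff power_eq_0_iff simp_thms)
  also have "\<dots> \<longleftrightarrow> v 1 ^ ?n = v 2 ^ ?n"
    unfolding q by (rule char2_power_inject[OF char])
  finally show ?thesis .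
qed

end

section \<open>Normalized vectors in projective dimension three\<close>

definition vec4 :: "'a::zero \<Rightarrow> 'a \<Rightarrow> 'a \<Rightarrow> 'a \<Rightarrow> nat \<Rightarrow> 'a" where
  "vec4 a b c d = (\<lambda>i. if i = 0 then a else if i = 1 then b else if i = 2 then c
     else if i = 3 then d else 0)"

lemma vec4_nth [simp]:
  "vec4 a b c d 0 = a" "vec4 a b c d 1 = b" "vec4 a b c d (Suc 0) = b"
  "vec4 a b c d 2 = c" "vec4 a b c d 3 = d"
  by (simp_all add: vec4_def)

lemma vec4_inject [simp]:
  "vec4 a b c d = vec4 a' b' c' d' \<longleftrightarrow> a = a' \<and> b = b' \<and> c = c' \<and> d = d'"
  by (metis vec4_nth)

lemma vec4_eqI:
  assumes "\<forall>i>3. v i = 0" "v 0 = a" "v 1 = b" "v 2 = c" "v 3 = d"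
  shows "v = vec4 a b c d"
proof
  fix i :: nat
  consider "i = 0" | "i = 1" | "i = 2" | "i = 3" | "i > 3"
    by linarith
  then show "v i = vec4 a b c d i"
    by cases (use assms in \<open>auto simp: vec4_def\<close>)
qed

lemma normalized_vectors_3_iff:
  "v \<in> normalized_vectors 3 \<longleftrightarrow> (\<exists>x y z. v = vec4 1 x y z) \<or> (\<exists>x y. v = vec4 0 1 x y)
     \<or> (\<exists>x. v = vec4 0 0 1 x) \<or> v = vec4 0 0 0 1"
    (is "_ \<longleftrightarrow> ?R")
proof
  assume "v \<in> normalized_vectors 3"
  then obtain i where v: "\<forall>i>3. v i = 0" and i: "i \<le> 3" "v i = 1" "\<forall>j<i. v j = 0"
    by (auto simp: normalized_vectors_def)
  have eq: "v 0 = a \<Longrightarrow> v 1 = b \<Longrightarrow> v 2 = c \<Longrightarrow> v 3 = d \<Longrightarrow> v = vec4 a b c d" for a b c d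
    using vec4_eqI[OF v] .
  consider "i = 0" | "i = 1" | "i = 2" | "i = 3"
    using i(1) by linarith
  then show ?R
  proof cases
    case 1
    then have "v = vec4 1 (v 1) (v 2) (v 3)"
      using i by (intro eq) auto
    then show ?thesis by blast
  next
    case 2
    then have "v = vec4 0 1 (v 2) (v 3)"
      using i by (intro eq) auto
    then show ?thesis by blast
  next
    case 3
    then have "v = vec4 0 0 1 (v 3)"
      using i by (intro eq) auto
    then show ?thesis by blast
  next
    case 4
    then have "v = vec4 0 0 0 1"
      using i by (intro eq) auto
    then show ?thesis by blast
  qed
next
  have I: "v \<in> normalized_vectors 3"
    if "\<forall>i>3. v i = 0" "i \<le> 3" "v i = 1" "\<forall>j<i. v j = 0" for i
    using that by (auto simp: normalized_vectors_def)
  assume ?R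
  then show "v \<in> normalized_vectors 3"
  proof (elim disjE exE)
    fix x y z assume "v = vec4 1 x y z"
    then show ?thesis by (intro I[of 0]) (auto simp: vec4_def)
  next
    fix x y assume "v = vec4 0 1 x y"
    then show ?thesis by (intro I[of 1]) (auto simp: vec4_def)
  next
    fix x assume "v = vec4 0 0 1 x"
    then show ?thesis by (intro I[of 2]) (auto simp: vec4_def)
  next
    assume "v = vec4 0 0 0 1"
    then show ?thesis by (intro I[of 3]) (auto simp: vec4_def)
  qed
qed

section \<open>Counting affine points and points at infinity\<close>

context quadratic_extension
begin

lemma card_V_3:
  assumes "e > 0"
  shows "card (V e 3 \<epsilon>) = q ^ 5 + card {t::'a. t ^ (sigma_exp e + 2) = 1} * q\<^sup>2 + 1"
proof -
  let ?n = "sigma_exp e + 2" and ?f = "homogenize (V_affine_pol e 3 \<epsilon>)"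
  let ?N = "{t::'a. t ^ ?n = 1}"
  define F where "F = (\<lambda>(x, y). {z. z ^ q + z = Gamma x + Gamma y})"
  \<comment> \<open>\<open>Z0\<close> collects the affine points, \<open>Z1\<close> the points at
    infinity other than the vertex of the cone, and \<open>Z2\<close> the vertex.\<close>
  define Z0 where "Z0 = (\<lambda>((x, y), z). vec4 1 x y z) ` (SIGMA p:UNIV. F p)"
  define Z1 where "Z1 = (\<lambda>(t, s). vec4 0 1 t s) ` (?N \<times> (UNIV :: 'a set))"
  define Z2 where "Z2 = {vec4 0 0 0 (1::'a)}"
  have affine: "eval_mpol (vec4 1 x y z) ?f = 0 \<longleftrightarrow> z \<in> F (x, y)" for x y z
    by (simp add: eval_homogenize_affine eval_V_affine_pol F_def)
  have infinity: "eval_mpol (vec4 0 x y z) ?f = 0 \<longleftrightarrow> x ^ ?n = y ^ ?n" for x y z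
    using eval_homogenize_V_infinity[OF assms, of "vec4 0 x y z"] by simp
  have "{v \<in> normalized_vectors 3. eval_mpol v ?f = 0} = Z0 \<union> Z1 \<union> Z2"
  proof (intro equalityI subsetI)
    fix v assume "v \<in> {v \<in> normalized_vectors 3. eval_mpol v ?f = 0}"
    then have v: "v \<in> normalized_vectors 3" "eval_mpol v ?f = 0"
      by auto
    from v(1) show "v \<in> Z0 \<union> Z1 \<union> Z2"
      unfolding normalized_vectors_3_iff
    proof (elim disjE exE)
      fix x y z assume "v = vec4 1 x y z"
      then show ?thesis
        using v(2) affine[of x y z] unfolding Z0_def by (auto intro!: image_eqI[of _ _ "((x, y), z)"])
    next
      fix x y assume "v = vec4 0 1 x y"
      then show ?thesis
        using v(2) infinity[of 1 x y] unfolding Z1_def by (auto intro!: image_eqI[of _ _ "(x, y)"])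
    next
      fix x assume "v = vec4 0 0 1 x"
      \<comment> \<open>Here the equation at infinity would read \<open>0 ^ ?n = 1 ^ ?n\<close>, so
        this case contributes no point.\<close>
      then show ?thesis
        using v(2) infinity[of 0 1 x] by simp
    next
      assume "v = vec4 0 0 0 1"
      then show ?thesis
        by (simp add: Z2_def)
    qed
  next
    fix v assume "v \<in> Z0 \<union> Z1 \<union> Z2"
    then show "v \<in> {v \<in> normalized_vectors 3. eval_mpol v ?f = 0}"
      using affine infinity by (auto simp: normalized_vectors_3_iff Z0_def Z1_def Z2_def)
  qed
  moreover have "card (Z0 \<union> Z1 \<union> Z2) = card Z0 + card Z1 + card Z2"
    by (subst card_Un_disjoint; (subst card_Un_disjoint)?) (auto simp: Z0_def Z1_def Z2_def)
  moreover have "card Z0 = q ^ 5"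
  proof -
    have "card Z0 = card (SIGMA p:UNIV. F p)"
      unfolding Z0_def by (rule card_image) (auto simp: inj_on_def)
    also have "\<dots> = (\<Sum>p\<in>UNIV. card (F p))"
      by (rule card_SigmaI) auto
    \<comment> \<open>The right-hand side lies in the subfield by \<open>Gamma_in\<close>, so each
      of the \<open>q ^ 4\<close> fibres has \<open>q\<close> elements.\<close>
    also have "\<dots> = (\<Sum>p\<in>(UNIV :: ('a \<times> 'a) set). q)"
      by (rule sum.cong) (auto simp: F_def Gamma_in intro!: card_trace_fibre subfield_add)
    also have "\<dots> = q ^ 5"
      by (simp add: card power_numeral_reduce)
    finally show ?thesis .
  qed
  moreover have "card Z1 = card ?N * q\<^sup>2"
  proof -
    have "card Z1 = card (?N \<times> (UNIV :: 'a set))"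
      unfolding Z1_def by (rule card_image) (auto simp: inj_on_def)
    then show ?thesis
      by (simp add: card_cartesian_product card)
  qed
  moreover have "card (V e 3 \<epsilon>) = card {v \<in> normalized_vectors 3. eval_mpol v ?f = 0}"
    unfolding V_def by (rule card_proj_zeros) (simp add: eval_homogenize_scale)
  ultimately show ?thesis
    by (simp add: Z2_def)
qed

end

theorem theorem3p2:
  fixes e q :: nat and \<epsilon> \<delta> :: "'a::{field,finite}"
  assumes "odd e" and "e \<ge> 3" and "q = 2 ^ e"
    and "CARD('a) = q ^ 2"
    and "\<epsilon> \<notin> subfield_q q"
    and "\<delta> \<in> subfield_q q" and "\<delta> \<noteq> 1" and "abs_trace e \<delta> = 1"
    and "\<epsilon> ^ 2 + \<epsilon> + \<delta> = 0"
  shows "([e = 1] (mod 4) \<longrightarrow> card (V e 3 \<epsilon>) = q ^ 5 + q ^ 2 + 1) \<and>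
         ([e = 3] (mod 4) \<longrightarrow> card (V e 3 \<epsilon>) = q ^ 5 + 3 * q ^ 2 + 1)"
proof -
  interpret quadratic_extension e q \<epsilon> \<delta>
    by unfold_locales (use assms in auto)
  obtain k where k: "e = 2 * k + 1"
    using \<open>odd e\<close> by (elim oddE)
  have "q\<^sup>2 = 2 ^ (e * 2)"
    unfolding \<open>q = 2 ^ e\<close> by (rule power_mult[symmetric])
  then have card2: "CARD('a) = 2 ^ (4 * k + 2)"
    using assms(4) k by simp
  then have card4: "CARD('a) = 4 ^ e"
    using k by (simp add: power_mult power_add)
  have sigma: "sigma_exp e = 2 ^ Suc k"
    by (simp add: sigma_exp_def k)
  have N: "card {t::'a. t ^ (sigma_exp e + 2) = 1} = (if even k then 1 else 3)"
    unfolding sigma roots_of_unity_exponent[OF card2]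
    using card_cube_roots_of_unity[OF card4] by simp
  \<comment> \<open>As \<open>e = 2 * k + 1\<close>, the residue of \<open>e\<close> modulo 4
    records the parity of \<open>k\<close>, which decides between one root and three.\<close>
  have "[e = 1] (mod 4) \<longleftrightarrow> even k" "[e = 3] (mod 4) \<longleftrightarrow> odd k"
    unfolding k cong_def by presburger+
  then show ?thesis
    using card_V_3 N assms(2) by auto
qed

end
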